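(* Let $(X,0)\subsetneq(\mathbb{R}^2,0)$ be a closed definable planar germ such that $\mathrm{Aff}(C_0X)=\mathbb{R}\times\{0\}$ and $X$ is filled horizontally. If $\theta(X,0)<2$, then $0\in\overline{M_X}$.
   Context: "Definable" means definable in a fixed polynomially bounded o-minimal structure on the field $\mathbb{R}$. The germ is represented by a closed definable set $X\subset\mathbb{R}^2$ with $0\in X$. $m(p)=\{x\in X\mid \|p-x\|=d(p,X)\}$ (Euclidean distance), and the medial axis is $M_X=\{p\in\mathbb{R}^2\mid \# m(p)>1\}$. The Peano tangent cone is $C_0X=\{w\mid \exists\,X\ni x_\nu\to 0,\ \exists\,\lambda_\nu>0:\ \lambda_\nu x_\nu\to w\}$; $\mathrm{Aff}$ denotes the affine hull. The assumption on $C_0X$ implies $B(0,2r)\cap X\cap\{x=0\}=\{0\}$ for all small $r>0$, where $B(0,2r)$ is the disk of radius $2r$ centered at $0$. $X$ is called filled horizontally if there is $r_0>0$ such that for every $0<r<r_0$ the set $B(0,2r)\setminus X$ has at most two connected components: one containing $(0,r)$ and (possibly the other) containing $(0,-r)$; that is, every component contains $(0,r)$ or $(0,-r)$. The general curvature is $\theta(X,0)=\sup\{\theta>0\mid (X,0)\subset\{(x,y)\mid |y|\leqslant c|x|^\theta\}\text{ for some constant } c>0\}\in[1,+\infty]$, where inclusion of germs means that the intersection of $X$ with some neighbourhood of $0$ is contained in the right-hand set. *)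

theory Defs
  imports "HOL-Analysis.Analysis"
begin

section \<open>Polynomially bounded o-minimal structures on the real field\<close>

text \<open>
  A point of \<open>R\<^sup>n\<close> is a list of length \<open>n\<close>, and \<open>S n\<close> is the collection of definable subsets of
  \<open>R\<^sup>n\<close>. Only the graphs of addition and multiplication are required explicitly: the order is
  definable by squares, and \<open>one_dim\<close> makes all singletons definable, so every real
  algebraic (hence semialgebraic) set is definable.
\<close>

definition Rn :: "nat \<Rightarrow> real list set" where
  "Rn n = {xs. length xs = n}"

locale ominimal_structure =
  fixes S :: "nat \<Rightarrow> real list set set"
  assumes subset_Rn: "A \<in> S n \<Longrightarrow> A \<subseteq> Rn n"
    and empty: "{} \<in> S n"
    and union: "A \<in> S n \<Longrightarrow> B \<in> S n \<Longrightarrow> A \<union> B \<in> S n"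
    and complement: "A \<in> S n \<Longrightarrow> Rn n - A \<in> S n"
    and prod_left: "A \<in> S n \<Longrightarrow> {t # xs | t xs. xs \<in> A} \<in> S (Suc n)"
    and prod_right: "A \<in> S n \<Longrightarrow> {xs @ [t] | xs t. xs \<in> A} \<in> S (Suc n)"
    and diagonal: "i < n \<Longrightarrow> j < n \<Longrightarrow> {xs \<in> Rn n. xs ! i = xs ! j} \<in> S n"
    and projection: "A \<in> S (Suc n) \<Longrightarrow> butlast ` A \<in> S n"
    and add_graph: "{[x, y, x + y] | x y. True} \<in> S 3"
    and mult_graph: "{[x, y, x * y] | x y. True} \<in> S 3"
    and one_dim: "{[t] | t. t \<in> T} \<in> S 1 \<longleftrightarrow>
      (\<exists>F. finite F \<and> (\<forall>I\<in>F. is_interval I) \<and> T = \<Union>F)"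
      \<comment> \<open>\<open>is_interval\<close> covers singletons and all bounded or unbounded intervals\<close>

locale poly_bounded_ominimal_structure = ominimal_structure +
  assumes poly_bounded: "\<And>f :: real \<Rightarrow> real. {[t, f t] | t. True} \<in> S 2 \<Longrightarrow>
      \<exists>N :: nat. eventually (\<lambda>t. \<bar>f t\<bar> \<le> t ^ N) at_top"

definition definable_planar :: "(nat \<Rightarrow> real list set set) \<Rightarrow> (real \<times> real) set \<Rightarrow> bool" where
  "definable_planar S X \<longleftrightarrow> {[x, y] | x y. (x, y) \<in> X} \<in> S 2"


section \<open>Medial axis, tangent cone and general curvature\<close>

text \<open>The norm and distance of the product type \<^typ>\<open>real \<times> real\<close> are the Euclidean ones.\<close>

definition nearest_points :: "'a::real_normed_vector set \<Rightarrow> 'a \<Rightarrow> 'a set" where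
  "nearest_points X p = {x \<in> X. norm (p - x) = infdist p X}"

text \<open>The condition \<open># m(p) > 1\<close> cannot be expressed by \<^const>\<open>card\<close>, which is 0 on infinite sets.\<close>

definition medial_axis :: "'a::real_normed_vector set \<Rightarrow> 'a set" where
  "medial_axis X = {p. \<exists>x\<in>nearest_points X p. \<exists>y\<in>nearest_points X p. x \<noteq> y}"

definition tangent_cone0 :: "'a::real_normed_vector set \<Rightarrow> 'a set" where
  "tangent_cone0 X = {w. \<exists>(x :: nat \<Rightarrow> 'a) (l :: nat \<Rightarrow> real).
     (\<forall>n. x n \<in> X) \<and> (\<forall>n. l n > 0) \<and> x \<longlonglongrightarrow> 0 \<and> (\<lambda>n. l n *\<^sub>R x n) \<longlonglongrightarrow> w}"

definition germ0_subset :: "'a::real_normed_vector set \<Rightarrow> 'a set \<Rightarrow> bool" where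
  "germ0_subset X Y \<longleftrightarrow> (\<exists>U. open U \<and> 0 \<in> U \<and> X \<inter> U \<subseteq> Y)"

text \<open>
  If no exponent is admissible the supremum below is \<open>-\<infinity>\<close>; this does not happen when
  the tangent cone at 0 lies in the horizontal axis, since then \<open>\<theta> = 1\<close> is admissible.
\<close>

definition general_curvature :: "(real \<times> real) set \<Rightarrow> ereal" where
  "general_curvature X = Sup {ereal \<theta> | \<theta>. \<theta> > 0 \<and>
     (\<exists>c>0. germ0_subset X {(x, y). \<bar>y\<bar> \<le> c * \<bar>x\<bar> powr \<theta>})}"

definition filled_horizontally :: "(real \<times> real) set \<Rightarrow> bool" where
  "filled_horizontally X \<longleftrightarrow> (\<exists>r0>0. \<forall>r. 0 < r \<and> r < r0 \<longrightarrow>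
     (\<forall>C\<in>components (ball 0 (2 * r) - X). (0, r) \<in> C \<or> (0, - r) \<in> C))"

end

(*
  If no medial axis point lies near 0, then every point near 0 has a unique nearest point in X,
  and Brouwer's theorem shows that a nearest point q of c stays nearest along the ray from q
  through c, for a uniform distance. Apply this to c = (0, s) with s -> 0: since X is tangent to
  the horizontal axis, the nearest point of c is o(s), so the rays converge to the vertical one
  and X avoids two open discs of a fixed radius that touch the axis at 0 from above and from below.
  This forces |y| <= C x^2 on X near 0, hence general curvature at least 2.
*)
theory Submission
  imports Defs
begin

section \<open>Nearest points away from the medial axis\<close>

lemma nearest_points_nonempty:
  fixes X :: "'a::euclidean_space set"
  assumes "closed X" "X \<noteq> {}"
  shows "nearest_points X p \<noteq> {}"
proof -
  obtain x where "x \<in> X" "infdist p X = dist p x"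
    using infdist_attains_inf[OF assms] .
  then have "x \<in> nearest_points X p" by (simp add: nearest_points_def dist_norm)
  then show ?thesis by blast
qed

text \<open>The inequality reverses the triangle inequality, so it places \<open>c\<close> on a
  shortest path from \<open>y\<close> to \<open>x\<close>. As \<open>infdist\<close> is 1-Lipschitz,
  a point of \<open>X\<close> closer to \<open>c\<close> than \<open>x\<close> would also be closer
  to \<open>y\<close> than \<open>x\<close>.\<close>

lemma nearest_points_between:
  fixes X :: "'a::real_normed_vector set"
  assumes "x \<in> nearest_points X y" and "norm (y - c) + norm (c - x) \<le> norm (y - x)"
  shows "x \<in> nearest_points X c"
proof -
  have x: "x \<in> X" "norm (y - x) = infdist y X"
    using assms(1) by (auto simp: nearest_points_def)
  have "infdist y X \<le> infdist c X + norm (y - c)"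
    using infdist_triangle[of y X c] by (simp add: dist_norm)
  moreover have "infdist c X \<le> norm (c - x)"
    using infdist_le[OF x(1), of c] by (simp add: dist_norm)
  ultimately show ?thesis
    using x assms(2) by (simp add: nearest_points_def)
qed

text \<open>Closed graph theorem: over a compact set the nearest points stay in a fixed ball, and a
  map into a compact set with closed graph is continuous.\<close>

lemma continuous_on_nearest_point:
  fixes X :: "'a::euclidean_space set"
  assumes "closed X" "compact K"
    and m: "\<And>y. y \<in> K \<Longrightarrow> m y \<in> nearest_points X y"
    and uniq: "\<And>y. y \<in> K \<Longrightarrow> y \<notin> medial_axis X"
  shows "continuous_on K m"
proof -
  have "compact ((\<lambda>y. infdist y X) ` K)"
    using assms(2) by (intro compact_continuous_image continuous_on_infdist continuous_on_id)
  then have "bounded ((\<lambda>y. infdist y X) ` K)" by (rule compact_imp_bounded)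
  then obtain B where B: "\<And>y. y \<in> K \<Longrightarrow> infdist y X \<le> B"
    unfolding bounded_real by (metis abs_le_D1 imageI)
  obtain C where C: "\<And>y. y \<in> K \<Longrightarrow> norm y \<le> C"
    using assms(2) compact_imp_bounded bounded_iff by metis
  have bound: "m y \<in> cball 0 (B + C)" if "y \<in> K" for y
  proof -
    have "norm (m y) \<le> norm (y - m y) + norm y"
      using norm_triangle_ineq4[of y "y - m y"] by simp
    then show ?thesis
      using B[OF that] C[OF that] m[OF that] by (auto simp: nearest_points_def)
  qed
  \<comment> \<open>Uniqueness of the nearest point turns the graph of the choice \<open>m\<close>
    into a set cut out by closed conditions.\<close>
  have "(\<lambda>y. (y, m y)) ` K = {z \<in> K \<times> X. norm (fst z - snd z) = infdist (fst z) X}"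
  proof (intro set_eqI iffI)
    fix z assume "z \<in> {z \<in> K \<times> X. norm (fst z - snd z) = infdist (fst z) X}"
    then obtain y x where z: "z = (y, x)" "y \<in> K" "x \<in> nearest_points X y"
      by (auto simp: nearest_points_def)
    then have "x = m y"
      using m[OF z(2)] uniq[OF z(2)] by (auto simp: medial_axis_def)
    then show "z \<in> (\<lambda>y. (y, m y)) ` K" using z by auto
  qed (use m in \<open>auto simp: nearest_points_def\<close>)
  moreover have "closed {z \<in> K \<times> X. norm (fst z - snd z) = infdist (fst z) X}"
  proof -
    have "closed (K \<times> X)"
      using assms by (simp add: closed_Times compact_imp_closed)
    moreover have "closed {z. norm (fst z - snd z) = infdist (fst z) X}"
      by (intro closed_Collect_eq continuous_on_norm continuous_on_diff continuous_on_fst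
          continuous_on_snd continuous_on_infdist continuous_on_id)
    ultimately have "closed (K \<times> X \<inter> {z. norm (fst z - snd z) = infdist (fst z) X})"
      by (rule closed_Int)
    then show ?thesis by (simp add: Int_def)
  qed
  ultimately have "closed ((\<lambda>y. (y, m y)) ` K)" by simp
  moreover have "m \<in> K \<rightarrow> cball 0 (B + C)" using bound by (rule Pi_I)
  ultimately show ?thesis
    using continuous_from_closed_graph[OF compact_cball] by metis
qed

text \<open>Brouwer is applied to the map that sends \<open>y\<close> to the point of the sphere
  about \<open>c\<close> lying opposite to \<open>m y\<close>. At a fixed point, \<open>c\<close>
  lies between \<open>y\<close> and \<open>m y\<close>, so \<open>m y\<close> is also nearest to
  \<open>c\<close> and equals \<open>q\<close> by uniqueness; the fixed point is then the point on
  the ray from \<open>q\<close>.\<close>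

lemma nearest_point_ray:
  fixes X :: "'a::euclidean_space set"
  assumes "closed X" "c \<notin> X" "0 < \<rho>"
    and uniq: "\<And>y. y \<in> cball c \<rho> \<Longrightarrow> y \<notin> medial_axis X"
    and q: "q \<in> nearest_points X c"
  shows "q \<in> nearest_points X (c + \<rho> *\<^sub>R sgn (c - q))"
proof -
  have "X \<noteq> {}" using q by (auto simp: nearest_points_def)
  then have "\<forall>y. \<exists>x. x \<in> nearest_points X y"
    using nearest_points_nonempty[OF assms(1)] by blast
  then obtain m where m: "\<And>y. m y \<in> nearest_points X y" by metis
  \<comment> \<open>Hence \<open>sgn (c - m y)\<close> never takes the default value 0: it is a unit
    vector depending continuously on \<open>y\<close>.\<close>
  have ne: "c \<noteq> m y" for y
    using m[of y] assms(2) by (auto simp: nearest_points_def)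
  define f where "f y = c + \<rho> *\<^sub>R sgn (c - m y)" for y
  have "continuous_on (cball c \<rho>) m"
    using continuous_on_nearest_point[OF assms(1) compact_cball] m uniq by blast
  then have "continuous_on (cball c \<rho>) f"
    unfolding f_def sgn_div_norm using ne by (intro continuous_intros) auto
  moreover have "f \<in> cball c \<rho> \<rightarrow> cball c \<rho>"
    using assms(3) by (auto simp: f_def dist_norm norm_sgn)
  ultimately obtain y where y: "y \<in> cball c \<rho>" "f y = y"
    using brouwer[OF compact_cball convex_cball, of c \<rho> f] assms(3)
    by (metis less_imp_le cball_eq_empty not_less)
  have yeq: "y = c + \<rho> *\<^sub>R sgn (c - m y)" using y(2) by (simp add: f_def)
  have "norm (y - m y) = norm (y - c) + norm (c - m y)"
  proof -
    have "c - m y = norm (c - m y) *\<^sub>R sgn (c - m y)"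
      using ne[of y] by (simp add: sgn_div_norm)
    then have "y - m y = (\<rho> + norm (c - m y)) *\<^sub>R sgn (c - m y)"
      using yeq by (metis add_diff_eq add.commute scaleR_add_left)
    then have "norm (y - m y) = \<rho> + norm (c - m y)"
      using ne[of y] assms(3) by (simp add: norm_sgn)
    moreover have "norm (y - c) = \<rho>"
      using yeq ne[of y] assms(3) by (metis add_diff_cancel_left' abs_of_pos mult.right_neutral
          norm_scaleR norm_sgn right_minus_eq)
    ultimately show ?thesis by simp
  qed
  then have "m y \<in> nearest_points X c"
    by (intro nearest_points_between[OF m]) simp
  moreover have "c \<notin> medial_axis X" using uniq assms(3) by simp
  ultimately have "m y = q" using q by (auto simp: medial_axis_def)
  then show ?thesis using m[of y] yeq by metis
qed

section \<open>Vectors in the polar of the tangent cone\<close>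

text \<open>By compactness of the unit sphere, the directions of points violating the bound ever
  closer to 0 would accumulate at a unit tangent vector \<open>w\<close> with
  \<open>v \<bullet> w\<close> at least \<epsilon>.\<close>

lemma tangent_cone0_dual_bound:
  fixes X :: "'a::euclidean_space set"
  assumes dual: "\<And>w. w \<in> tangent_cone0 X \<Longrightarrow> v \<bullet> w \<le> 0" and "0 < \<epsilon>"
  shows "\<exists>\<delta>>0. \<forall>x\<in>X. norm x < \<delta> \<longrightarrow> v \<bullet> x \<le> \<epsilon> * norm x"
proof (rule ccontr)
  assume "\<not> ?thesis"
  then have "\<exists>x\<in>X. norm x < inverse (real (Suc n)) \<and> v \<bullet> x > \<epsilon> * norm x" for n
    by (meson inverse_positive_iff_positive not_le of_nat_0_less_iff zero_less_Suc)
  then obtain x where x: "\<And>n. x n \<in> X" "\<And>n. norm (x n) < inverse (real (Suc n))"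
    "\<And>n. v \<bullet> x n > \<epsilon> * norm (x n)" by metis
  have nz: "x n \<noteq> 0" for n using x(3)[of n] by auto
  have "\<forall>n. sgn (x n) \<in> sphere 0 1" using nz by (simp add: norm_sgn)
  then obtain w r where w: "strict_mono r" "((\<lambda>n. sgn (x n)) \<circ> r) \<longlonglongrightarrow> w"
    using compact_sphere[of "0::'a" 1] unfolding compact_def by meson
  have "x \<longlonglongrightarrow> 0"
    using x(2) by (intro Lim_null_comparison[OF _ LIMSEQ_inverse_real_of_nat] always_eventually
        allI less_imp_le)
  then have "(\<lambda>n. x (r n)) \<longlonglongrightarrow> 0"
    using LIMSEQ_subseq_LIMSEQ[OF _ w(1)] by (simp add: o_def)
  then have "w \<in> tangent_cone0 X"
    using x(1) w(2) nz unfolding tangent_cone0_def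
    by (intro CollectI exI[of _ "\<lambda>n. x (r n)"] exI[of _ "\<lambda>n. inverse (norm (x (r n)))"])
      (simp add: o_def sgn_div_norm)
  then have "v \<bullet> w \<le> 0" by (rule dual)
  moreover have "\<epsilon> \<le> v \<bullet> w"
  proof (rule LIMSEQ_le_const)
    show "(\<lambda>n. v \<bullet> sgn (x (r n))) \<longlonglongrightarrow> v \<bullet> w"
      using w(2) by (intro tendsto_intros) (simp add: o_def)
    show "\<exists>N. \<forall>n\<ge>N. \<epsilon> \<le> v \<bullet> sgn (x (r n))"
      using x(3) nz by (auto simp: sgn_div_norm field_simps intro: less_imp_le)
  qed
  ultimately show False using \<open>0 < \<epsilon>\<close> by simp
qed

text \<open>The ray lemma cannot start at 0, which lies in \<open>X\<close>. It is applied at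
  \<open>s *\<^sub>R v\<close> with the fixed length \<rho>, and the distance identity at the end of
  the ray is passed to the limit as \<open>s\<close> tends to 0.\<close>

lemma nearest_point_along_normal:
  fixes X :: "'a::euclidean_space set"
  assumes "closed X" "0 \<in> X" "0 < \<rho>" "norm v = 1"
    and uniq: "\<And>y. y \<in> ball 0 (2 * \<rho>) \<Longrightarrow> y \<notin> medial_axis X"
    and dual: "\<And>w. w \<in> tangent_cone0 X \<Longrightarrow> v \<bullet> w \<le> 0"
  shows "0 \<in> nearest_points X (\<rho> *\<^sub>R v)"
proof -
  have "\<forall>p. \<exists>x. x \<in> nearest_points X p"
    using nearest_points_nonempty[OF assms(1)] assms(2) by blast
  then obtain m where m: "\<And>p. m p \<in> nearest_points X p" by metis
  have mX: "m p \<in> X" for p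
    using m[of p] by (simp add: nearest_points_def)
  have mle: "norm (p - m p) \<le> norm (p - x)" if "x \<in> X" for p x
    using m[of p] infdist_le[OF that, of p] by (simp add: nearest_points_def dist_norm)
  have small: "\<forall>\<^sub>F s in at_right 0. s *\<^sub>R v \<notin> X \<and> norm (m (s *\<^sub>R v) /\<^sub>R s) \<le> \<epsilon>"
    if "0 < \<epsilon>" "\<epsilon> < 1" for \<epsilon>
  proof -
    have "\<exists>\<delta>>0. \<forall>x\<in>X. norm x < \<delta> \<longrightarrow> v \<bullet> x \<le> \<epsilon> / 2 * norm x"
      using that(1) by (intro tangent_cone0_dual_bound dual) simp_all
    then obtain \<delta> where \<delta>: "\<delta> > 0" "\<And>x. x \<in> X \<Longrightarrow> norm x < \<delta> \<Longrightarrow> v \<bullet> x \<le> \<epsilon> / 2 * norm x"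
      by blast
    \<comment> \<open>Since 0 is in \<open>X\<close>, the nearest point of
      \<open>s *\<^sub>R v\<close> has norm at most \<open>2 * s\<close>; hence the threshold
      \<open>\<delta> / 2\<close>.\<close>
    have "s *\<^sub>R v \<notin> X \<and> norm (m (s *\<^sub>R v) /\<^sub>R s) \<le> \<epsilon>" if s: "0 < s" "s < \<delta> / 2" for s
    proof
      have vv: "v \<bullet> v = 1" using assms(4) by (simp add: dot_square_norm)
      show "s *\<^sub>R v \<notin> X"
      proof
        assume "s *\<^sub>R v \<in> X"
        then have "s \<le> \<epsilon> / 2 * s" using \<delta>(2)[of "s *\<^sub>R v"] s \<delta>(1) assms(4) vv by simp
        then show False using s \<open>\<epsilon> < 1\<close> by simp
      qed
      define q where "q = m (s *\<^sub>R v)"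
      have le: "norm (s *\<^sub>R v - q) \<le> s"
        using mle[OF assms(2), of "s *\<^sub>R v"] s assms(4) by (simp add: q_def)
      have "norm q \<le> norm (s *\<^sub>R v) + norm (s *\<^sub>R v - q)"
        using norm_triangle_ineq4[of "s *\<^sub>R v" "s *\<^sub>R v - q"] by simp
      then have "norm q < \<delta>" using le s assms(4) by simp
      then have vq: "v \<bullet> q \<le> \<epsilon> / 2 * norm q" using \<delta>(2) mX q_def by simp
      have "(norm (s *\<^sub>R v - q))\<^sup>2 \<le> s\<^sup>2" using le by (simp add: power_mono)
      \<comment> \<open>Expanding the square cancels the two terms \<open>s\<^sup>2\<close>; the
        factor 2 that remains is absorbed by the choice of \<open>\<epsilon> / 2\<close> in the
        polar bound.\<close>
      then have "(norm q)\<^sup>2 \<le> 2 * s * (v \<bullet> q)"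
        unfolding power2_norm_eq_inner using vv
        by (simp add: algebra_simps inner_commute power2_eq_square)
      also have "\<dots> \<le> 2 * s * (\<epsilon> / 2 * norm q)"
        using vq s by (intro mult_left_mono) auto
      finally have "norm q * norm q \<le> (s * \<epsilon>) * norm q"
        by (simp add: power2_eq_square)
      then have "norm q \<le> s * \<epsilon>"
        using s \<open>0 < \<epsilon>\<close> by (cases "q = 0") auto
      then show "norm (m (s *\<^sub>R v) /\<^sub>R s) \<le> \<epsilon>"
        using s by (simp add: q_def field_simps)
    qed
    then show ?thesis
      using \<delta>(1) by (auto simp: eventually_at_right intro!: exI[of _ "\<delta> / 2"])
  qed
  have ratio: "((\<lambda>s. m (s *\<^sub>R v) /\<^sub>R s) \<longlongrightarrow> 0) (at_right 0)"
  proof (rule tendstoI)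
    fix e :: real assume "0 < e"
    then obtain d where d: "0 < d" "d < min e 1"
      using dense[of 0 "min e 1"] by auto
    then have "\<forall>\<^sub>F s in at_right 0. s *\<^sub>R v \<notin> X \<and> norm (m (s *\<^sub>R v) /\<^sub>R s) \<le> d"
      by (intro small) simp_all
    then show "\<forall>\<^sub>F s in at_right 0. dist (m (s *\<^sub>R v) /\<^sub>R s) 0 < e"
      unfolding dist_0_norm dist_commute[of _ 0]
      by (rule eventually_mono) (use d in linarith)
  qed
  have id0: "((\<lambda>s::real. s) \<longlongrightarrow> 0) (at_right 0)" by (rule tendsto_ident_at)
  have pos: "\<forall>\<^sub>F s in at_right 0. (0::real) < s" by (simp add: eventually_at_right_less)
  have "((\<lambda>s. s *\<^sub>R (m (s *\<^sub>R v) /\<^sub>R s)) \<longlongrightarrow> 0 *\<^sub>R 0) (at_right 0)"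
    by (intro tendsto_intros id0 ratio)
  then have "((\<lambda>s. s *\<^sub>R (m (s *\<^sub>R v) /\<^sub>R s)) \<longlongrightarrow> 0) (at_right 0)" by simp
  moreover have "\<forall>\<^sub>F s in at_right 0. s *\<^sub>R (m (s *\<^sub>R v) /\<^sub>R s) = m (s *\<^sub>R v)"
    using pos by eventually_elim simp
  ultimately have lim_m: "((\<lambda>s. m (s *\<^sub>R v)) \<longlongrightarrow> 0) (at_right 0)"
    by (rule Lim_transform_eventually)
  have "((\<lambda>s. sgn (v - m (s *\<^sub>R v) /\<^sub>R s)) \<longlongrightarrow> sgn (v - 0)) (at_right 0)"
    using assms(4) by (intro tendsto_intros ratio) auto
  then have "((\<lambda>s. sgn (v - m (s *\<^sub>R v) /\<^sub>R s)) \<longlongrightarrow> v) (at_right 0)"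
    using assms(4) by (simp add: sgn_div_norm)
  \<comment> \<open>\<open>sgn\<close> is invariant under positive scaling, so smallness of the
    nearest point relative to \<open>s\<close> controls the direction of the ray.\<close>
  moreover have "\<forall>\<^sub>F s in at_right 0. sgn (v - m (s *\<^sub>R v) /\<^sub>R s) = sgn (s *\<^sub>R v - m (s *\<^sub>R v))"
    using pos
  proof eventually_elim
    case (elim s)
    have "s *\<^sub>R v - m (s *\<^sub>R v) = s *\<^sub>R (v - m (s *\<^sub>R v) /\<^sub>R s)"
      using elim by (simp add: scaleR_diff_right)
    then show ?case using elim by (simp add: sgn_scaleR)
  qed
  ultimately have lim_sgn: "((\<lambda>s. sgn (s *\<^sub>R v - m (s *\<^sub>R v))) \<longlongrightarrow> v) (at_right 0)"
    by (rule Lim_transform_eventually)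
  define y where "y s = s *\<^sub>R v + \<rho> *\<^sub>R sgn (s *\<^sub>R v - m (s *\<^sub>R v))" for s
  have "(y \<longlongrightarrow> 0 *\<^sub>R v + \<rho> *\<^sub>R v) (at_right 0)"
    unfolding y_def by (intro tendsto_intros id0 lim_sgn)
  then have lim_y: "(y \<longlongrightarrow> \<rho> *\<^sub>R v) (at_right 0)" by simp
  have "\<forall>\<^sub>F s in at_right 0. s < \<rho>"
    using assms(3) by (auto simp: eventually_at_right)
  \<comment> \<open>The value 1/2 is an arbitrary choice in (0,1) giving
    \<open>s *\<^sub>R v \<notin> X\<close>, and \<open>s < \<rho>\<close> keeps the ball of radius
    \<rho> about \<open>s *\<^sub>R v\<close> inside \<open>ball 0 (2 * \<rho>)\<close>.\<close>
  then have "\<forall>\<^sub>F s in at_right 0. m (s *\<^sub>R v) \<in> nearest_points X (y s)"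
    using small[of "1 / 2", simplified] pos
  proof eventually_elim
    case (elim s)
    have "z \<in> ball 0 (2 * \<rho>)" if "z \<in> cball (s *\<^sub>R v) \<rho>" for z
      using that elim assms(4) norm_triangle_ineq2[of z "s *\<^sub>R v"]
      by (simp add: dist_norm norm_minus_commute)
    then show ?case
      unfolding y_def using elim m
      by (intro nearest_point_ray[OF assms(1) _ assms(3) uniq]) auto
  qed
  \<comment> \<open>The two sides tend to \<open>norm (\<rho> *\<^sub>R v)\<close> and to
    \<open>infdist (\<rho> *\<^sub>R v) X\<close>, which therefore agree.\<close>
  then have "\<forall>\<^sub>F s in at_right 0. norm (y s - m (s *\<^sub>R v)) = infdist (y s) X"
    by eventually_elim (simp add: nearest_points_def)
  moreover have "((\<lambda>s. norm (y s - m (s *\<^sub>R v))) \<longlongrightarrow> norm (\<rho> *\<^sub>R v - 0)) (at_right 0)"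
    by (intro tendsto_intros lim_y lim_m)
  ultimately have "((\<lambda>s. infdist (y s) X) \<longlongrightarrow> norm (\<rho> *\<^sub>R v - 0)) (at_right 0)"
    by (rule Lim_transform_eventually[rotated])
  moreover have "((\<lambda>s. infdist (y s) X) \<longlongrightarrow> infdist (\<rho> *\<^sub>R v) X) (at_right 0)"
    by (intro tendsto_infdist lim_y)
  ultimately have "norm (\<rho> *\<^sub>R v - 0) = infdist (\<rho> *\<^sub>R v) X"
    using tendsto_unique[OF trivial_limit_at_right_real] by blast
  then show ?thesis using assms(2) by (simp add: nearest_points_def)
qed

section \<open>From tangent discs to the general curvature\<close>

text \<open>The point \<open>x\<close> lies outside the open ball about \<open>p\<close> whose
  boundary passes through 0; squaring \<open>norm p \<le> norm (p - x)\<close> gives the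
  claim.\<close>

lemma inner_le_if_nearest_0:
  fixes X :: "'a::real_inner set"
  assumes "0 \<in> nearest_points X p" "x \<in> X"
  shows "2 * (p \<bullet> x) \<le> (norm x)\<^sup>2"
proof -
  have "norm p \<le> norm (p - x)"
    using assms infdist_le[of x X p] by (simp add: nearest_points_def dist_norm)
  then have "(norm p)\<^sup>2 \<le> (norm (p - x))\<^sup>2" by (simp add: power_mono)
  then show ?thesis by (simp add: power2_norm_eq_inner algebra_simps inner_commute)
qed

theorem theorem4p1:
  fixes S :: "nat \<Rightarrow> real list set set" and X :: "(real \<times> real) set"
  assumes "poly_bounded_ominimal_structure S"
    and "definable_planar S X"
    and "closed X"
    and "0 \<in> X"
    and "\<not> germ0_subset UNIV X"
    and "affine hull (tangent_cone0 X) = UNIV \<times> {0}"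
    and "filled_horizontally X"
    and "general_curvature X < 2"
  shows "0 \<in> closure (medial_axis X)"
proof (rule ccontr)
  assume "0 \<notin> closure (medial_axis X)"
  then obtain e where e: "e > 0" "\<And>y. y \<in> medial_axis X \<Longrightarrow> e \<le> dist y 0"
    by (meson closure_approachable not_le)
  \<comment> \<open>The ball of radius \<open>2 * \<rho> = e\<close> misses the medial axis.\<close>
  define \<rho> where "\<rho> = e / 2"
  have \<rho>: "\<rho> > 0" and uniq: "\<And>y. y \<in> ball 0 (2 * \<rho>) \<Longrightarrow> y \<notin> medial_axis X"
    using e by (force simp: \<rho>_def)+
  have "tangent_cone0 X \<subseteq> UNIV \<times> {0}"
    using hull_subset[of "tangent_cone0 X" affine] assms(6) by simp
  \<comment> \<open>Tangent vectors are horizontal, so both vertical directions are polar to the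
    cone; \<open>t\<close> will be 1 and -1, one for each disc.\<close>
  then have dual: "(0, t) \<bullet> w \<le> 0" if "w \<in> tangent_cone0 X" for t w
    using that by (auto simp: inner_prod_def)
  have near: "0 \<in> nearest_points X (\<rho> *\<^sub>R (0, t))" if "\<bar>t\<bar> = 1" for t :: real
    using nearest_point_along_normal[OF assms(3,4) \<rho> _ uniq dual] that
    by (simp add: norm_Pair)
  have "\<bar>y\<bar> \<le> (1 / \<rho>) * \<bar>x\<bar> powr 2" if "(x, y) \<in> X" "norm (x, y) < \<rho>" for x y
  proof -
    have y: "\<bar>y\<bar> \<le> \<rho>"
      using that(2) norm_snd_le[of y x] by simp
    have "2 * (\<rho> * y) \<le> x\<^sup>2 + y\<^sup>2" "2 * (\<rho> * - y) \<le> x\<^sup>2 + y\<^sup>2"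
      using inner_le_if_nearest_0[OF near that(1), of 1]
        inner_le_if_nearest_0[OF near that(1), of "-1"]
      by (simp_all add: inner_prod_def norm_Pair)
    then have "2 * (\<rho> * \<bar>y\<bar>) \<le> x\<^sup>2 + y\<^sup>2" by (simp add: abs_if)
    \<comment> \<open>Near 0 the quadratic term in \<open>y\<close> is absorbed by half of the
      left-hand side.\<close>
    moreover have "y\<^sup>2 \<le> \<rho> * \<bar>y\<bar>"
      using mult_right_mono[OF y, of "\<bar>y\<bar>"] by (simp add: power2_eq_square)
    ultimately have "\<rho> * \<bar>y\<bar> \<le> x\<^sup>2" by linarith
    then show ?thesis using \<rho> by (simp add: field_simps)
  qed
  then have "germ0_subset X {(x, y). \<bar>y\<bar> \<le> (1 / \<rho>) * \<bar>x\<bar> powr 2}"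
    unfolding germ0_subset_def using \<rho> by (intro exI[of _ "ball 0 \<rho>"]) auto
  \<comment> \<open>The exponent 2 is admissible with constant \<open>1 / \<rho>\<close>, so the
    supremum is at least 2.\<close>
  then have "ereal 2 \<le> general_curvature X"
    unfolding general_curvature_def using \<rho> by (intro Sup_upper CollectI exI[of _ 2])
      (auto intro!: exI[of _ "1 / \<rho>"])
  then show False using assms(8) by simp
qed

end
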